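(* Let $(X,\mu,\mathcal{E},\mathcal{F})$ be a symmetric Dirichlet space with conservative semigroup and $\mu(X)=1$, and assume that $\mathcal{E}$ satisfies a Poincaré (spectral gap) inequality with spectral gap $\lambda_1>0$. Let $\alpha\in(0,1]$ and define the $\alpha$-Cheeger constant of $X$ by \[ h_\alpha=\inf\frac{\|\mathbf{1}_E\|_{1,\alpha}}{\mu(E)}, \] where the infimum runs over all measurable sets $E\subset X$ with $0<\mu(E)\le\frac12$ and $\mathbf{1}_E\in\mathbf{B}^{1,\alpha}(X)$. Then \[ h_\alpha\ge(1-e^{-1})\,\lambda_1^\alpha . \]
   Context: $X$ is a topological space equipped with a Radon measure $\mu$; $\mathcal{E}$ is a symmetric Dirichlet form on $L^2(X,\mu)$ with domain $\mathcal{F}$; $\{P_t\}_{t\ge0}$ is the associated Markovian semigroup, extended to all $L^p(X,\mu)$; conservative means $P_t1=1$. The spectral gap $\lambda_1$ is the best (largest) constant with $\lambda_1\left(\int_Xf^2\,d\mu-\left(\int_Xf\,d\mu\right)^2\right)\le\mathcal{E}(f,f)$ for all $f\in\mathcal{F}$. For $f\in L^1(X,\mu)$ and $\alpha\ge0$, \[ \|f\|_{1,\alpha}=\sup_{t>0}t^{-\alpha}\int_XP_t(|f-f(y)|)(y)\,d\mu(y), \] where the inner expression is understood through the heat kernel measures of $P_t$ (if $P_t$ has a heat kernel $p_t(x,y)$, the integral is $\int_X\int_X|f(x)-f(y)|p_t(x,y)\,d\mu(x)\,d\mu(y)$), and $\mathbf{B}^{1,\alpha}(X)=\{f\in L^1(X,\mu):\|f\|_{1,\alpha}<\infty\}$.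 *)

theory Defs
  imports "HOL-Probability.Probability"
begin

text \<open>Borel measures that are locally finite and inner regular with respect to compact sets.
  The space need not be Hausdorff, so measurability of the approximating compact sets is required
  explicitly.\<close>

definition radon_measure :: "'a::topological_space measure \<Rightarrow> bool" where
  "radon_measure M \<longleftrightarrow>
     sets M = sets borel \<and>
     (\<forall>x. \<exists>U. open U \<and> x \<in> U \<and> emeasure M U < \<infinity>) \<and>
     (\<forall>A \<in> sets M. emeasure M A = (SUP K \<in> {K. K \<subseteq> A \<and> compact K \<and> K \<in> sets M}. emeasure M K))"


text \<open>Elements of $L^2$ are represented by square-integrable functions; functions that agree
  almost everywhere are not identified, so the notions below are required to respect
  almost-everywhere equality.\<close>

definition L2 :: "'a measure \<Rightarrow> ('a \<Rightarrow> real) set" where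
  "L2 M = {f \<in> borel_measurable M. integrable M (\<lambda>x. (f x)\<^sup>2)}"

definition l2_inner :: "'a measure \<Rightarrow> ('a \<Rightarrow> real) \<Rightarrow> ('a \<Rightarrow> real) \<Rightarrow> real" where
  "l2_inner M f g = (\<integral>x. f x * g x \<partial>M)"

definition l2_norm :: "'a measure \<Rightarrow> ('a \<Rightarrow> real) \<Rightarrow> real" where
  "l2_norm M f = sqrt (l2_inner M f f)"


definition densely_defined :: "'a measure \<Rightarrow> ('a \<Rightarrow> real) set \<Rightarrow> bool" where
  "densely_defined M F \<longleftrightarrow>
     F \<subseteq> L2 M \<and>
     (\<lambda>x. 0) \<in> F \<and>
     (\<forall>f \<in> F. \<forall>g \<in> F. \<forall>c. (\<lambda>x. c * f x + g x) \<in> F) \<and>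
     (\<forall>f \<in> F. \<forall>g \<in> borel_measurable M. (AE x in M. f x = g x) \<longrightarrow> g \<in> F) \<and>
     (\<forall>f \<in> L2 M. \<forall>\<epsilon>>0. \<exists>g \<in> F. l2_norm M (\<lambda>x. f x - g x) < \<epsilon>)"

definition symmetric_form ::
  "'a measure \<Rightarrow> ('a \<Rightarrow> real) set \<Rightarrow> (('a \<Rightarrow> real) \<Rightarrow> ('a \<Rightarrow> real) \<Rightarrow> real) \<Rightarrow> bool" where
  "symmetric_form M F \<E> \<longleftrightarrow>
     (\<forall>f \<in> F. \<forall>g \<in> F. \<E> f g = \<E> g f) \<and>
     (\<forall>f \<in> F. \<forall>g \<in> F. \<forall>h \<in> F. \<forall>c. \<E> (\<lambda>x. c * f x + g x) h = c * \<E> f h + \<E> g h) \<and>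
     (\<forall>f \<in> F. \<E> f f \<ge> 0) \<and>
     (\<forall>f \<in> F. \<forall>g \<in> F. \<forall>h \<in> F. (AE x in M. f x = g x) \<longrightarrow> \<E> f h = \<E> g h)"

definition form1 ::
  "'a measure \<Rightarrow> (('a \<Rightarrow> real) \<Rightarrow> ('a \<Rightarrow> real) \<Rightarrow> real) \<Rightarrow> ('a \<Rightarrow> real) \<Rightarrow> real" where
  "form1 M \<E> f = \<E> f f + l2_inner M f f"

definition closed_form ::
  "'a measure \<Rightarrow> ('a \<Rightarrow> real) set \<Rightarrow> (('a \<Rightarrow> real) \<Rightarrow> ('a \<Rightarrow> real) \<Rightarrow> real) \<Rightarrow> bool" where
  "closed_form M F \<E> \<longleftrightarrow>
     (\<forall>u :: nat \<Rightarrow> 'a \<Rightarrow> real.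
        (\<forall>n. u n \<in> F) \<longrightarrow>
        (\<forall>\<epsilon>>0. \<exists>N. \<forall>m\<ge>N. \<forall>n\<ge>N. form1 M \<E> (\<lambda>x. u m x - u n x) < \<epsilon>) \<longrightarrow>
        (\<exists>v \<in> F. (\<lambda>n. form1 M \<E> (\<lambda>x. u n x - v x)) \<longlonglongrightarrow> 0))"

definition markovian_form ::
  "('a \<Rightarrow> real) set \<Rightarrow> (('a \<Rightarrow> real) \<Rightarrow> ('a \<Rightarrow> real) \<Rightarrow> real) \<Rightarrow> bool" where
  "markovian_form F \<E> \<longleftrightarrow>
     (\<forall>f \<in> F. (\<lambda>x. min (max (f x) 0) 1) \<in> F \<and>
        \<E> (\<lambda>x. min (max (f x) 0) 1) (\<lambda>x. min (max (f x) 0) 1) \<le> \<E> f f)"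

definition symmetric_dirichlet_form ::
  "'a measure \<Rightarrow> ('a \<Rightarrow> real) set \<Rightarrow> (('a \<Rightarrow> real) \<Rightarrow> ('a \<Rightarrow> real) \<Rightarrow> real) \<Rightarrow> bool" where
  "symmetric_dirichlet_form M F \<E> \<longleftrightarrow>
     densely_defined M F \<and> symmetric_form M F \<E> \<and> closed_form M F \<E> \<and> markovian_form F \<E>"

definition symmetric_dirichlet_space ::
  "'a::topological_space measure \<Rightarrow> ('a \<Rightarrow> real) set \<Rightarrow> (('a \<Rightarrow> real) \<Rightarrow> ('a \<Rightarrow> real) \<Rightarrow> real) \<Rightarrow> bool"
  where
  "symmetric_dirichlet_space M F \<E> \<longleftrightarrow> radon_measure M \<and> symmetric_dirichlet_form M F \<E>"


text \<open>Strongly continuous semigroups of symmetric Markovian contractions on $L^2$.\<close>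

definition markovian_semigroup ::
  "'a measure \<Rightarrow> (real \<Rightarrow> ('a \<Rightarrow> real) \<Rightarrow> 'a \<Rightarrow> real) \<Rightarrow> bool" where
  "markovian_semigroup M P \<longleftrightarrow>
     (\<forall>t\<ge>0. \<forall>f \<in> L2 M. P t f \<in> L2 M) \<and>
     (\<forall>t\<ge>0. \<forall>f \<in> L2 M. \<forall>g \<in> L2 M. \<forall>c.
        AE x in M. P t (\<lambda>y. c * f y + g y) x = c * P t f x + P t g x) \<and>
     (\<forall>t\<ge>0. \<forall>f \<in> L2 M. \<forall>g \<in> L2 M. l2_inner M (P t f) g = l2_inner M f (P t g)) \<and>
     (\<forall>t\<ge>0. \<forall>f \<in> L2 M. l2_norm M (P t f) \<le> l2_norm M f) \<and>
     (\<forall>f \<in> L2 M. AE x in M. P 0 f x = f x) \<and>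
     (\<forall>s\<ge>0. \<forall>t\<ge>0. \<forall>f \<in> L2 M. AE x in M. P (s + t) f x = P s (P t f) x) \<and>
     (\<forall>f \<in> L2 M. ((\<lambda>t. l2_norm M (\<lambda>x. P t f x - f x)) \<longlongrightarrow> 0) (at_right 0)) \<and>
     (\<forall>t\<ge>0. \<forall>f \<in> L2 M. (AE x in M. 0 \<le> f x \<and> f x \<le> 1) \<longrightarrow>
        (AE x in M. 0 \<le> P t f x \<and> P t f x \<le> 1))"

text \<open>The graph of the infinitesimal generator: $u$ is in its domain and is mapped to $w$.\<close>

definition generator_rel ::
  "'a measure \<Rightarrow> (real \<Rightarrow> ('a \<Rightarrow> real) \<Rightarrow> 'a \<Rightarrow> real) \<Rightarrow> ('a \<Rightarrow> real) \<Rightarrow> ('a \<Rightarrow> real) \<Rightarrow> bool" where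
  "generator_rel M P u w \<longleftrightarrow> u \<in> L2 M \<and> w \<in> L2 M \<and>
     ((\<lambda>t. l2_norm M (\<lambda>x. (P t u x - u x) / t - w x)) \<longlongrightarrow> 0) (at_right 0)"

text \<open>The graph of the self-adjoint operator $A$ of a closed form: $u$ is in the domain of $A$ and
  $Au = w$ iff $u$ is in the form domain and $\mathcal{E}(u,v) = -\langle w, v\rangle$ for all $v$
  in the form domain.\<close>

definition form_operator_rel ::
  "'a measure \<Rightarrow> ('a \<Rightarrow> real) set \<Rightarrow> (('a \<Rightarrow> real) \<Rightarrow> ('a \<Rightarrow> real) \<Rightarrow> real) \<Rightarrow>
     ('a \<Rightarrow> real) \<Rightarrow> ('a \<Rightarrow> real) \<Rightarrow> bool" where
  "form_operator_rel M F \<E> u w \<longleftrightarrow> u \<in> F \<and> w \<in> L2 M \<and> (\<forall>v \<in> F. \<E> u v = - l2_inner M w v)"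

text \<open>That is, $P_t = e^{tA}$ with $A$ the operator of the form.\<close>

definition associated_semigroup ::
  "'a measure \<Rightarrow> ('a \<Rightarrow> real) set \<Rightarrow> (('a \<Rightarrow> real) \<Rightarrow> ('a \<Rightarrow> real) \<Rightarrow> real) \<Rightarrow>
     (real \<Rightarrow> ('a \<Rightarrow> real) \<Rightarrow> 'a \<Rightarrow> real) \<Rightarrow> bool" where
  "associated_semigroup M F \<E> P \<longleftrightarrow>
     markovian_semigroup M P \<and> (\<forall>u w. generator_rel M P u w \<longleftrightarrow> form_operator_rel M F \<E> u w)"

text \<open>Only used for finite measures, where the constant 1 is in $L^2$.\<close>

definition conservative :: "'a measure \<Rightarrow> (real \<Rightarrow> ('a \<Rightarrow> real) \<Rightarrow> 'a \<Rightarrow> real) \<Rightarrow> bool" where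
  "conservative M P \<longleftrightarrow> (\<forall>t\<ge>0. AE x in M. P t (\<lambda>_. 1) x = 1)"

text \<open>The heat kernel measures $p_t(x,\cdot)$ of the semigroup, written \<open>p t x\<close>:
  $P_t f(x) = \int f(y)\, p_t(x,dy)$.\<close>

definition heat_kernel_measures ::
  "'a measure \<Rightarrow> (real \<Rightarrow> ('a \<Rightarrow> real) \<Rightarrow> 'a \<Rightarrow> real) \<Rightarrow> (real \<Rightarrow> 'a \<Rightarrow> 'a measure) \<Rightarrow> bool" where
  "heat_kernel_measures M P p \<longleftrightarrow>
     (\<forall>t>0. p t \<in> M \<rightarrow>\<^sub>M subprob_algebra M) \<and>
     (\<forall>t>0. \<forall>f \<in> L2 M. AE x in M. integrable (p t x) f \<and> P t f x = (\<integral>y. f y \<partial>p t x))"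


definition poincare_inequality ::
  "'a measure \<Rightarrow> ('a \<Rightarrow> real) set \<Rightarrow> (('a \<Rightarrow> real) \<Rightarrow> ('a \<Rightarrow> real) \<Rightarrow> real) \<Rightarrow> real \<Rightarrow> bool" where
  "poincare_inequality M F \<E> c \<longleftrightarrow>
     (\<forall>f \<in> F. c * ((\<integral>x. (f x)\<^sup>2 \<partial>M) - (\<integral>x. f x \<partial>M)\<^sup>2) \<le> \<E> f f)"

definition is_spectral_gap ::
  "'a measure \<Rightarrow> ('a \<Rightarrow> real) set \<Rightarrow> (('a \<Rightarrow> real) \<Rightarrow> ('a \<Rightarrow> real) \<Rightarrow> real) \<Rightarrow> real \<Rightarrow> bool" where
  "is_spectral_gap M F \<E> gap \<longleftrightarrow>
     poincare_inequality M F \<E> gap \<and> (\<forall>c. poincare_inequality M F \<E> c \<longrightarrow> c \<le> gap)"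


definition besov_seminorm ::
  "'a measure \<Rightarrow> (real \<Rightarrow> 'a \<Rightarrow> 'a measure) \<Rightarrow> real \<Rightarrow> ('a \<Rightarrow> real) \<Rightarrow> ennreal" where
  "besov_seminorm M p \<alpha> f =
     (SUP t\<in>{0<..}. ennreal (t powr (- \<alpha>)) *
        (\<integral>\<^sup>+ y. (\<integral>\<^sup>+ x. ennreal \<bar>f x - f y\<bar> \<partial>p t y) \<partial>M))"

definition besov_space ::
  "'a measure \<Rightarrow> (real \<Rightarrow> 'a \<Rightarrow> 'a measure) \<Rightarrow> real \<Rightarrow> ('a \<Rightarrow> real) set" where
  "besov_space M p \<alpha> = {f. integrable M f \<and> besov_seminorm M p \<alpha> f < \<infinity>}"

text \<open>The infimum over the empty family is \<open>\<infinity>\<close>.\<close>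

definition cheeger_constant ::
  "'a measure \<Rightarrow> (real \<Rightarrow> 'a \<Rightarrow> 'a measure) \<Rightarrow> real \<Rightarrow> ennreal" where
  "cheeger_constant M p \<alpha> =
     (INF A \<in> {A \<in> sets M. 0 < measure M A \<and> measure M A \<le> 1/2 \<and>
                 (indicator A :: 'a \<Rightarrow> real) \<in> besov_space M p \<alpha>}.
        besov_seminorm M p \<alpha> (indicator A) / emeasure M A)"

end

theory Submission imports Defs begin

text \<open>Form and semigroup are linked only through equality of the graphs of their operators.
  The Poincare inequality therefore controls the variance only along orbits that start in the
  generator domain, where half its derivative is the inner product of \<open>P t u\<close> and
  \<open>P t w\<close>. Two closures carry the estimate to indicators: resolvents approximate
  elements of \<open>F\<close> by elements of the generator domain, and \<open>F\<close> is dense in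
  \<open>L2 M\<close>. Contractivity makes the decay stable under both.

  Every t > 0 yields the factor t powr (-\<alpha>) * (1 - exp (-gap * t)). The choice t = 1/gap does
  not maximise it, but turns the power into gap powr \<alpha> and leaves a constant independent of
  \<alpha>.

  Functions are representatives rather than classes, so semigroup identities hold only almost
  everywhere and are moved into inner products by \<open>l2_inner_cong_AE\<close>.\<close>

text \<open>For $\mu(E) \le 1/2$ and $t > 0$, symmetry and conservativeness give
  $\int P_t(|1_E - 1_E(y)|)(y)\,d\mu(y) = 2(\mu(E) - \|P_{t/2} 1_E\|_2^2)$, and by the
  exponential decay of the variance this is at least
  $2(1 - e^{-\lambda_1 t})\mu(E)(1 - \mu(E)) \ge (1 - e^{-\lambda_1 t})\mu(E)$.
  Take $t = 1/\lambda_1$. The decay is proved for initial data in the domain of the generator by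
  Euler steps; that domain is dense because the resolvent of the form exists.\<close>

section \<open>Nonnegative symmetric forms\<close>

text \<open>One set of rules serves three forms: the L2 inner product, the Dirichlet form, and their
  weighted sum in the resolvent construction. Semidefiniteness is the right level, since a nonzero
  function vanishing almost everywhere has norm zero.\<close>

locale nonneg_form =
  fixes V :: "('a \<Rightarrow> real) set" and B :: "('a \<Rightarrow> real) \<Rightarrow> ('a \<Rightarrow> real) \<Rightarrow> real"
  assumes zero: "(\<lambda>x. 0) \<in> V"
    and lin: "\<And>f g c. f \<in> V \<Longrightarrow> g \<in> V \<Longrightarrow> (\<lambda>x. c * f x + g x) \<in> V"
    and sym: "\<And>f g. f \<in> V \<Longrightarrow> g \<in> V \<Longrightarrow> B f g = B g f"
    and lin_left: "\<And>f g h c. f \<in> V \<Longrightarrow> g \<in> V \<Longrightarrow> h \<in> V \<Longrightarrow>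
      B (\<lambda>x. c * f x + g x) h = c * B f h + B g h"
    and nonneg: "\<And>f. f \<in> V \<Longrightarrow> 0 \<le> B f f"
begin

lemma scale: "f \<in> V \<Longrightarrow> (\<lambda>x. c * f x) \<in> V"
  using lin[of f "\<lambda>x. 0" c] zero by simp

lemma add: "f \<in> V \<Longrightarrow> g \<in> V \<Longrightarrow> (\<lambda>x. f x + g x) \<in> V"
  using lin[of f g 1] by simp

lemma diff: "f \<in> V \<Longrightarrow> g \<in> V \<Longrightarrow> (\<lambda>x. f x - g x) \<in> V"
  using lin[of g f "-1"] by simp

lemma diff_left:
  "f \<in> V \<Longrightarrow> g \<in> V \<Longrightarrow> h \<in> V \<Longrightarrow> B (\<lambda>x. f x - g x) h = B f h - B g h"
  using lin_left[of g f h "-1"] by simp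

lemma scale_left: "f \<in> V \<Longrightarrow> h \<in> V \<Longrightarrow> B (\<lambda>x. c * f x) h = c * B f h"
  using lin_left[of f "\<lambda>x. 0" h c] lin_left[of "\<lambda>x. 0" "\<lambda>x. 0" h 1] zero by simp

lemma add_left:
  "f \<in> V \<Longrightarrow> g \<in> V \<Longrightarrow> h \<in> V \<Longrightarrow> B (\<lambda>x. f x + g x) h = B f h + B g h"
  using lin_left[of f g h 1] by simp

lemma scale_right: "f \<in> V \<Longrightarrow> h \<in> V \<Longrightarrow> B h (\<lambda>x. c * f x) = c * B h f"
  using scale_left[of f h c] sym[of h f] sym[OF scale, of f h c] by simp

lemma add_right:
  "f \<in> V \<Longrightarrow> g \<in> V \<Longrightarrow> h \<in> V \<Longrightarrow> B h (\<lambda>x. f x + g x) = B h f + B h g"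
  using add_left[of f g h] sym[of h f] sym[of h g] sym[OF add, of f g h] by simp

lemma diff_right:
  "f \<in> V \<Longrightarrow> g \<in> V \<Longrightarrow> h \<in> V \<Longrightarrow> B h (\<lambda>x. f x - g x) = B h f - B h g"
  using diff_left[of f g h] sym[of h f] sym[of h g] sym[OF diff, of f g h] by simp

lemmas bilinear = add_left add_right diff_left diff_right scale_left scale_right

lemma square_add:
  assumes "f \<in> V" "g \<in> V"
  shows "B (\<lambda>x. f x + c * g x) (\<lambda>x. f x + c * g x) = B f f + 2 * c * B f g + c\<^sup>2 * B g g"
  using assms sym[of g f] by (simp add: bilinear add scale power2_eq_square algebra_simps)

lemma square_add_le:
  assumes "f \<in> V" "g \<in> V"
  shows "B (\<lambda>x. f x + g x) (\<lambda>x. f x + g x) \<le> 2 * B f f + 2 * B g g"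
  using nonneg[OF diff[OF assms]] assms sym[of g f] by (simp add: bilinear add diff)

lemma Cauchy_Schwarz:
  assumes "f \<in> V" "g \<in> V"
  shows "(B f g)\<^sup>2 \<le> B f f * B g g"
proof (cases "B g g = 0")
  case True
  have nn: "0 \<le> B f f + 2 * c * B f g" for c
    using nonneg[OF add[OF assms(1) scale[OF assms(2), of c]]] square_add[OF assms, of c] True by simp
  have "B f g = 0"
  proof (rule ccontr)
    assume "B f g \<noteq> 0"
    \<comment> \<open>This \<open>c\<close> makes the affine function in \<open>nn\<close> equal to
      -1.\<close>
    then show False using nn[of "- (B f f + 1) / (2 * B f g)"] by (simp add: field_simps)
  qed
  then show ?thesis using True by simp
next
  case False
  then have pos: "B g g > 0" using nonneg[OF assms(2)] by simp
  \<comment> \<open>The coefficient - B f g / B g g minimises the quadratic polynomial of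
    \<open>square_add\<close>.\<close>
  have "0 \<le> B f f + 2 * (- B f g / B g g) * B f g + (- B f g / B g g)\<^sup>2 * B g g"
    using nonneg[OF add[OF assms(1) scale[OF assms(2)]]] square_add[OF assms] by metis
  also have "\<dots> = B f f - (B f g)\<^sup>2 / B g g"
    using pos by (simp add: field_simps power2_eq_square)
  finally show ?thesis using pos by (simp add: field_simps)
qed

lemma abs_le_sqrt:
  assumes "f \<in> V" "g \<in> V"
  shows "\<bar>B f g\<bar> \<le> sqrt (B f f) * sqrt (B g g)"
  using real_sqrt_le_mono[OF Cauchy_Schwarz[OF assms]] by (simp add: real_sqrt_mult)

lemma tendsto_left:
  assumes "\<And>n. u n \<in> V" "v \<in> V" "h \<in> V"
    and lim: "(\<lambda>n. B (\<lambda>x. u n x - v x) (\<lambda>x. u n x - v x)) \<longlonglongrightarrow> 0"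
  shows "(\<lambda>n. B (u n) h) \<longlonglongrightarrow> B v h"
proof -
  have "(\<lambda>n. sqrt (B (\<lambda>x. u n x - v x) (\<lambda>x. u n x - v x)) * sqrt (B h h)) \<longlonglongrightarrow> 0"
    using tendsto_mult_left_zero[OF tendsto_real_sqrt[OF lim, unfolded real_sqrt_zero]] by simp
  moreover have "\<forall>n. norm (B (\<lambda>x. u n x - v x) h) \<le>
      sqrt (B (\<lambda>x. u n x - v x) (\<lambda>x. u n x - v x)) * sqrt (B h h)"
    using abs_le_sqrt assms diff by simp
  ultimately have "(\<lambda>n. B (\<lambda>x. u n x - v x) h) \<longlonglongrightarrow> 0"
    by (rule Lim_null_comparison[OF always_eventually, rotated])
  then show ?thesis
    using assms by (simp add: diff_left LIM_zero_iff)
qed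

lemma tendsto_square:
  assumes "\<And>n. u n \<in> V" "v \<in> V"
    and lim: "(\<lambda>n. B (\<lambda>x. u n x - v x) (\<lambda>x. u n x - v x)) \<longlonglongrightarrow> 0"
  shows "(\<lambda>n. B (u n) (u n)) \<longlonglongrightarrow> B v v"
proof -
  \<comment> \<open>Expanding around \<open>v\<close> leaves one square, which tends to 0 by
    assumption, and a term linear in \<open>u n\<close>, covered by
    \<open>tendsto_left\<close>.\<close>
  have eq: "B (u n) (u n) = B (\<lambda>x. u n x - v x) (\<lambda>x. u n x - v x) + 2 * B (u n) v - B v v" for n
    using assms(1)[of n] assms(2) sym[of "u n" v] by (simp add: bilinear diff)
  have "(\<lambda>n. B (u n) (u n)) \<longlonglongrightarrow> 0 + 2 * B v v - B v v"
    unfolding eq by (intro tendsto_intros lim tendsto_left assms)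
  then show ?thesis by simp
qed

end

section \<open>Square-integrable functions\<close>

lemma L2_integrable_mult:
  assumes "f \<in> L2 M" "g \<in> L2 M"
  shows "integrable M (\<lambda>x. f x * g x)"
proof (rule Bochner_Integration.integrable_bound)
  show "integrable M (\<lambda>x. (f x)\<^sup>2 + (g x)\<^sup>2)" "(\<lambda>x. f x * g x) \<in> borel_measurable M"
    using assms by (auto simp: L2_def)
  have "\<bar>f x * g x\<bar> \<le> (f x)\<^sup>2 + (g x)\<^sup>2" for x
    using sum_squares_bound[of "\<bar>f x\<bar>" "\<bar>g x\<bar>"] mult_nonneg_nonneg[of "\<bar>f x\<bar>" "\<bar>g x\<bar>"]
    unfolding abs_mult power2_abs by linarith
  then show "AE x in M. norm (f x * g x) \<le> norm ((f x)\<^sup>2 + (g x)\<^sup>2)"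
    by simp
qed

lemma nonneg_form_L2: "nonneg_form (L2 M) (l2_inner M)"
proof
  show "(\<lambda>x. 0) \<in> L2 M" by (simp add: L2_def)
  fix f g h :: "'a \<Rightarrow> real" and c :: real
  assume fg: "f \<in> L2 M" "g \<in> L2 M"
  have "(\<lambda>x. (c * f x + g x)\<^sup>2) =
      (\<lambda>x. c\<^sup>2 * (f x)\<^sup>2 + 2 * c * (f x * g x) + (g x)\<^sup>2)"
    by (auto simp: power2_eq_square algebra_simps)
  then show "(\<lambda>x. c * f x + g x) \<in> L2 M"
    using fg L2_integrable_mult[OF fg] by (auto simp: L2_def)
  show "l2_inner M f g = l2_inner M g f"
    by (simp add: l2_inner_def mult.commute)
  assume h: "h \<in> L2 M"
  show "l2_inner M (\<lambda>x. c * f x + g x) h = c * l2_inner M f h + l2_inner M g h"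
    using L2_integrable_mult[OF fg(1) h] L2_integrable_mult[OF fg(2) h]
    by (simp add: l2_inner_def algebra_simps)
qed (simp add: l2_inner_def)

interpretation L2: nonneg_form "L2 M" "l2_inner M" for M
  by (rule nonneg_form_L2)

lemma l2_inner_cong_AE:
  assumes "f \<in> L2 M" "f' \<in> L2 M" "g \<in> L2 M" "g' \<in> L2 M"
    and "AE x in M. f x = f' x" "AE x in M. g x = g' x"
  shows "l2_inner M f g = l2_inner M f' g'"
  unfolding l2_inner_def
proof (rule integral_cong_AE)
  show "AE x in M. f x * g x = f' x * g' x"
    using assms(5,6) by eventually_elim simp
qed (use assms(1-4) in \<open>auto simp: L2_def\<close>)

lemma l2_norm_square: "f \<in> L2 M \<Longrightarrow> (l2_norm M f)\<^sup>2 = l2_inner M f f"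
  by (simp add: l2_norm_def L2.nonneg)

text \<open>Under a probability measure this is the variance, the bracket in the Poincare
  inequality. Inner products make the bilinear rules and the symmetry of \<open>P t\<close> directly
  applicable.\<close>

definition l2_var :: "'a measure \<Rightarrow> ('a \<Rightarrow> real) \<Rightarrow> real" where
  "l2_var M f = l2_inner M f f - (l2_inner M f (\<lambda>_. 1))\<^sup>2"

lemma (in prob_space) one_L2: "(\<lambda>_. 1) \<in> L2 M"
  by (simp add: L2_def)

text \<open>Cauchy-Schwarz against the constant 1, which has norm one. Nonnegativity is what later
  allows a decay factor to be replaced by a larger one.\<close>

lemma (in prob_space) l2_var_nonneg:
  assumes "f \<in> L2 M"
  shows "0 \<le> l2_var M f"
proof -
  have "l2_inner M (\<lambda>_. 1) (\<lambda>_. 1) = 1" by (simp add: l2_inner_def prob_space)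
  then show ?thesis
    using L2.Cauchy_Schwarz[OF assms one_L2] by (simp add: l2_var_def)
qed

lemma (in prob_space) tendsto_l2_var:
  assumes "\<And>n. u n \<in> L2 M" "v \<in> L2 M"
    and "(\<lambda>n. l2_inner M (\<lambda>x. u n x - v x) (\<lambda>x. u n x - v x)) \<longlonglongrightarrow> 0"
  shows "(\<lambda>n. l2_var M (u n)) \<longlonglongrightarrow> l2_var M v"
  unfolding l2_var_def
  using L2.tendsto_square[OF assms] L2.tendsto_left[OF assms(1,2) one_L2 assms(3)]
  by (rule tendsto_diff[OF _ tendsto_power])

section \<open>Density of the domain of the operator of a closed form\<close>

text \<open>The resolvent of the form, obtained by minimising $\mathcal{E}(v,v) + b \|v - f\|^2$.\<close>

lemma form_resolvent:
  assumes dirichlet: "symmetric_dirichlet_form M F \<E>"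
    and f: "f \<in> F" and b: "1 \<le> b"
  obtains u where "form_operator_rel M F \<E> u (\<lambda>x. b * (u x - f x))"
    and "b * l2_inner M (\<lambda>x. u x - f x) (\<lambda>x. u x - f x) \<le> \<E> f f"
proof -
  have dense: "densely_defined M F" and symform: "symmetric_form M F \<E>"
    and closed: "closed_form M F \<E>"
    using dirichlet by (auto simp: symmetric_dirichlet_form_def)
  have sub: "F \<subseteq> L2 M" using dense by (simp add: densely_defined_def)
  then have L: "v \<in> F \<Longrightarrow> v \<in> L2 M" for v by blast
  interpret E: nonneg_form F \<E>
    using dense symform by unfold_locales (unfold densely_defined_def symmetric_form_def, blast+)
  \<comment> \<open>\<open>Q\<close> is the quadratic part of the functional \<open>J\<close> below.
    Since b is at least 1, it lies between \<open>form1\<close> and b times \<open>form1\<close>, so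
    closedness of the form is completeness for \<open>Q\<close>.\<close>
  define Q where "Q v h = \<E> v h + b * l2_inner M v h" for v h
  interpret Q: nonneg_form F Q
  proof
    show "(\<lambda>x. 0) \<in> F" by (rule E.zero)
    show "(\<lambda>x. c * g x + h x) \<in> F" if "g \<in> F" "h \<in> F" for c g h
      by (rule E.lin[OF that])
    show "Q g h = Q h g" if "g \<in> F" "h \<in> F" for g h
      unfolding Q_def using E.sym[OF that] L2.sym[OF L L, OF that] by simp
    show "Q (\<lambda>x. c * g x + h x) k = c * Q g k + Q h k" if "g \<in> F" "h \<in> F" "k \<in> F" for c g h k
      unfolding Q_def E.lin_left[OF that] L2.lin_left[OF L L L, OF that] by (simp add: algebra_simps)
    show "0 \<le> Q g g" if "g \<in> F" for g
      unfolding Q_def using b E.nonneg[OF that] L2.nonneg[OF L, OF that] by simp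
  qed
  define N where "N v = l2_inner M (\<lambda>x. v x - f x) (\<lambda>x. v x - f x)" for v
  define J where "J v = \<E> v v + b * N v" for v
  have J_nonneg: "0 \<le> J v" if "v \<in> F" for v
    using that b L2.nonneg[OF L2.diff[OF L L]] f E.nonneg by (simp add: J_def N_def)
  define m where "m = (INF v\<in>F. J v)"
  have bdd: "bdd_below (J ` F)" using J_nonneg by (auto intro!: bdd_belowI[of _ 0])
  have m_le: "m \<le> J v" if "v \<in> F" for v
    unfolding m_def by (rule cINF_lower[OF bdd that])
  have "\<exists>v\<in>F. J v < m + 1 / real (Suc n)" for n
    using cINF_less_iff[OF _ bdd, of "m + 1 / real (Suc n)"] f by (auto simp: m_def)
  then obtain u where u: "\<And>n. u n \<in> F" and Ju: "\<And>n. J (u n) < m + 1 / real (Suc n)"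
    by metis
  have expand: "J v = Q v v - 2 * b * l2_inner M v f + b * l2_inner M f f" if "v \<in> F" for v
    using that f by (simp add: J_def N_def Q_def L2.bilinear L2.diff L L2.sym[of f M v] algebra_simps)
  \<comment> \<open>The linear and constant parts of \<open>J\<close> cancel in this combination. As
    \<open>J\<close> at the midpoint is at least \<open>m\<close>, near-minimisers are close to each
    other.\<close>
  have parallelogram: "Q (\<lambda>x. v x - w x) (\<lambda>x. v x - w x) =
      2 * J v + 2 * J w - 4 * J (\<lambda>x. (1/2) * (v x + w x))" if v: "v \<in> F" and w: "w \<in> F" for v w
    using v w f expand[OF v] expand[OF w] expand[OF E.scale[OF E.add[OF v w], of "1/2"]] Q.sym[OF v w]
    by (simp add: Q.bilinear Q.diff Q.add Q.scale L2.bilinear L2.add L2.scale L del: times_divide_eq_left)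
       (simp add: algebra_simps)
  have form1_le: "form1 M \<E> v \<le> Q v v" if "v \<in> F" for v
    using mult_right_mono[OF b L2.nonneg[OF L[OF that]]] by (simp add: form1_def Q_def)
  have cauchy: "\<exists>K. \<forall>i\<ge>K. \<forall>j\<ge>K. form1 M \<E> (\<lambda>x. u i x - u j x) < e" if e: "0 < e" for e
  proof -
    obtain K where K: "4 / e < real (Suc K)"
      using reals_Archimedean2 by (metis less_trans lessI of_nat_less_iff)
    have "form1 M \<E> (\<lambda>x. u i x - u j x) < e" if ij: "K \<le> i" "K \<le> j" for i j
    proof -
      have "form1 M \<E> (\<lambda>x. u i x - u j x) \<le> 2 * J (u i) + 2 * J (u j) - 4 * m"
        using form1_le[OF E.diff[OF u u, of i j]] parallelogram[OF u u, of i j]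
          m_le[OF E.scale[OF E.add[OF u u], of "1/2" i j]] by linarith
      also have "\<dots> < 2 * (1 / real (Suc i)) + 2 * (1 / real (Suc j))"
        using Ju[of i] Ju[of j] by linarith
      also have "\<dots> \<le> 4 * (1 / real (Suc K))"
        using frac_le[of 1 1 "real (Suc K)" "real (Suc i)"] frac_le[of 1 1 "real (Suc K)" "real (Suc j)"] ij
        by simp
      also have "\<dots> < e" using K e by (simp add: field_simps)
      finally show ?thesis .
    qed
    then show ?thesis by blast
  qed
  then obtain v where v: "v \<in> F" and lim1: "(\<lambda>n. form1 M \<E> (\<lambda>x. u n x - v x)) \<longlonglongrightarrow> 0"
    using closed u unfolding closed_form_def by blast
  have Q_le: "Q w w \<le> b * form1 M \<E> w" if "w \<in> F" for w
    using mult_right_mono[OF b E.nonneg[OF that]] by (simp add: form1_def Q_def algebra_simps)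
  have limQ: "(\<lambda>n. Q (\<lambda>x. u n x - v x) (\<lambda>x. u n x - v x)) \<longlonglongrightarrow> 0"
  proof (rule Lim_null_comparison[OF always_eventually])
    show "\<forall>n. norm (Q (\<lambda>x. u n x - v x) (\<lambda>x. u n x - v x)) \<le> b * form1 M \<E> (\<lambda>x. u n x - v x)"
      using Q_le Q.nonneg E.diff u v by simp
    show "(\<lambda>n. b * form1 M \<E> (\<lambda>x. u n x - v x)) \<longlonglongrightarrow> 0"
      using tendsto_mult_right_zero[OF lim1] by simp
  qed
  \<comment> \<open>The first-order condition is obtained without showing that \<open>v\<close>
    attains \<open>m\<close>: each near-minimiser \<open>u n\<close> is perturbed by c * h, where
    \<open>J\<close> can drop by less than 1 / Suc n, and only then n tends to infinity.\<close>
  have euler: "Q v h = b * l2_inner M f h" if h: "h \<in> F" for h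
  proof -
    define D where "D = Q v h - b * l2_inner M f h"
    have ineq: "0 \<le> 2 * c * D + c\<^sup>2 * Q h h" for c
    proof (rule LIMSEQ_le_const)
      show "(\<lambda>n. 2 * c * (Q (u n) h - b * l2_inner M f h) + c\<^sup>2 * Q h h + 1 / real (Suc n))
          \<longlonglongrightarrow> 2 * c * D + c\<^sup>2 * Q h h"
        using tendsto_add[OF tendsto_add[OF tendsto_mult_left[OF
            tendsto_diff[OF Q.tendsto_left[OF u v h limQ] tendsto_const]] tendsto_const]
          LIMSEQ_inverse_real_of_nat]
        by (simp add: D_def inverse_eq_divide)
      have "0 \<le> 2 * c * (Q (u n) h - b * l2_inner M f h) + c\<^sup>2 * Q h h + 1 / real (Suc n)" for n
      proof -
        have "J (\<lambda>x. u n x + c * h x) =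
            J (u n) + 2 * c * (Q (u n) h - b * l2_inner M f h) + c\<^sup>2 * Q h h"
          using expand[OF u, of n] expand[OF E.add[OF u E.scale[OF h]], of n c] Q.square_add[OF u h, of n c]
            L[OF u] L[OF h] L[OF f]
          by (simp add: L2.bilinear L2.scale L2.sym[of h M f] algebra_simps)
        then show ?thesis
          using m_le[OF E.add[OF u E.scale[OF h]], of n c] Ju[of n] by linarith
      qed
      then show "\<exists>K. \<forall>n\<ge>K. 0 \<le> 2 * c * (Q (u n) h - b * l2_inner M f h) + c\<^sup>2 * Q h h + 1 / real (Suc n)"
        by blast
    qed
    have "D = 0"
    proof (rule ccontr)
      assume "D \<noteq> 0"
      \<comment> \<open>Adding 1 keeps the divisor positive even if \<open>Q h h\<close> vanishes;
        the test value c = - D / q still makes the expression in \<open>ineq\<close>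
        negative.\<close>
      define q where "q = Q h h + 1"
      have q: "q > 0" using Q.nonneg[OF h] by (simp add: q_def)
      have "0 \<le> 2 * (- D / q) * D + (- D / q)\<^sup>2 * (q - 1)"
        using ineq[of "- D / q"] by (simp add: q_def)
      also have "\<dots> = - (D\<^sup>2 / q) - (D / q)\<^sup>2"
        using q by (simp add: field_simps power2_eq_square)
      also have "\<dots> < 0" using q \<open>D \<noteq> 0\<close>
        by (smt (verit) divide_pos_pos zero_less_power2 zero_le_power2)
      finally show False by simp
    qed
    then show ?thesis by (simp add: D_def)
  qed
  show thesis
  proof
    have d: "(\<lambda>x. v x - f x) \<in> F" by (rule E.diff[OF v f])
    have *: "\<E> v h = - (b * l2_inner M (\<lambda>x. v x - f x) h)" if "h \<in> F" for h
      using euler[OF that] that v f by (simp add: Q_def L2.diff_left L algebra_simps)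
    then show "form_operator_rel M F \<E> v (\<lambda>x. b * (v x - f x))"
      using v f d by (auto simp: form_operator_rel_def L L2.scale L2.scale_left)
    \<comment> \<open>Completing the square bounds E(v,f) - E(v,v) by E(f,f)/4. By \<open>*\<close>
      with h = v - f, the left side is b times the squared distance from \<open>v\<close> to
      \<open>f\<close>.\<close>
    have "0 \<le> \<E> (\<lambda>x. v x + (-1/2) * f x) (\<lambda>x. v x + (-1/2) * f x)"
      by (intro E.nonneg E.add E.scale v f)
    then show "b * l2_inner M (\<lambda>x. v x - f x) (\<lambda>x. v x - f x) \<le> \<E> f f"
      using *[OF d] E.square_add[OF v f, of "-1/2"] E.diff_right[OF v f v] E.nonneg[OF f]
      by (simp add: power2_eq_square)
  qed
qed

section \<open>Exponential decay of the variance\<close>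

locale poincare_semigroup = prob_space M for M :: "'a measure" +
  fixes F \<E> P and gap :: real
  assumes dirichlet: "symmetric_dirichlet_form M F \<E>"
    and associated: "associated_semigroup M F \<E> P"
    and conservative: "conservative M P"
    and poincare: "poincare_inequality M F \<E> gap"
    and gap_pos: "0 < gap"
begin

section \<open>Basic properties of the semigroup\<close>

lemma semigroup: "markovian_semigroup M P"
  using associated by (simp add: associated_semigroup_def)

lemma P_L2: "0 \<le> t \<Longrightarrow> f \<in> L2 M \<Longrightarrow> P t f \<in> L2 M"
  using semigroup by (simp add: markovian_semigroup_def)

lemma P_linear: "0 \<le> t \<Longrightarrow> f \<in> L2 M \<Longrightarrow> g \<in> L2 M \<Longrightarrow>
    AE x in M. P t (\<lambda>y. c * f y + g y) x = c * P t f x + P t g x"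
  using semigroup by (simp add: markovian_semigroup_def)

lemma P_symmetric: "0 \<le> t \<Longrightarrow> f \<in> L2 M \<Longrightarrow> g \<in> L2 M \<Longrightarrow>
    l2_inner M (P t f) g = l2_inner M f (P t g)"
  using semigroup by (simp add: markovian_semigroup_def)

lemma P_contraction: "0 \<le> t \<Longrightarrow> f \<in> L2 M \<Longrightarrow> l2_norm M (P t f) \<le> l2_norm M f"
  using semigroup by (simp add: markovian_semigroup_def)

lemma P_zero: "f \<in> L2 M \<Longrightarrow> AE x in M. P 0 f x = f x"
  using semigroup by (simp add: markovian_semigroup_def)

lemma P_add: "0 \<le> s \<Longrightarrow> 0 \<le> t \<Longrightarrow> f \<in> L2 M \<Longrightarrow> AE x in M. P (s + t) f x = P s (P t f) x"
  using semigroup by (simp add: markovian_semigroup_def)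

lemma P_contraction_square:
  assumes "0 \<le> t" "f \<in> L2 M"
  shows "l2_inner M (P t f) (P t f) \<le> l2_inner M f f"
  using P_contraction[OF assms] by (simp add: l2_norm_def)

lemma P_diff:
  assumes "0 \<le> t" "f \<in> L2 M" "g \<in> L2 M"
  shows "AE x in M. P t (\<lambda>y. f y - g y) x = P t f x - P t g x"
  using P_linear[OF assms(1,3,2), of "-1"] by simp

text \<open>Symmetry moves \<open>P t\<close> onto the constant 1, which conservativeness fixes.
  Hence variance changes along the flow are changes of the squared norm alone.\<close>

lemma P_mean:
  assumes "0 \<le> t" "f \<in> L2 M"
  shows "l2_inner M (P t f) (\<lambda>_. 1) = l2_inner M f (\<lambda>_. 1)"
proof -
  have "l2_inner M f (P t (\<lambda>_. 1)) = l2_inner M f (\<lambda>_. 1)"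
    using assms conservative by (intro l2_inner_cong_AE) (auto simp: P_L2 one_L2 conservative_def)
  then show ?thesis using P_symmetric[OF assms one_L2] by simp
qed

lemma F_L2: "f \<in> F \<Longrightarrow> f \<in> L2 M"
  using dirichlet by (auto simp: symmetric_dirichlet_form_def densely_defined_def)

section \<open>The generator along an orbit\<close>

text \<open>\<open>P t\<close> commutes with the difference quotients, so the error for
  \<open>P t u\<close> is \<open>P t\<close> applied to the error for \<open>u\<close>, and
  contractivity bounds it. This makes the Poincare inequality available at every time of the
  orbit.\<close>

lemma P_generator:
  assumes gen: "generator_rel M P u w" and t: "0 \<le> t"
  shows "generator_rel M P (P t u) (P t w)"
proof -
  have u: "u \<in> L2 M" and w: "w \<in> L2 M"
    and lim: "((\<lambda>s. l2_norm M (\<lambda>x. (P s u x - u x) / s - w x)) \<longlongrightarrow> 0) (at_right 0)"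
    using gen by (auto simp: generator_rel_def)
  have bound: "l2_norm M (\<lambda>x. (P s (P t u) x - P t u x) / s - P t w x) \<le>
      l2_norm M (\<lambda>x. (P s u x - u x) / s - w x)" if s: "0 < s" for s
  proof -
    have d: "(\<lambda>x. P s u x - u x) \<in> L2 M" using s by (intro L2.diff P_L2 u) auto
    define r where "r = (\<lambda>x. (1/s) * (P s u x - u x) + - 1 * w x)"
    have r: "r \<in> L2 M" unfolding r_def by (intro L2.add L2.scale d w)
    have r_eq: "(\<lambda>x. (P s u x - u x) / s - w x) = r" by (simp add: r_def)
    have "AE x in M. (P s (P t u) x - P t u x) / s - P t w x = P t r x"
    proof -
      have mw: "(\<lambda>x. - 1 * w x) \<in> L2 M" by (intro L2.scale w)
      have 1: "AE x in M. P t r x =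
          (1/s) * P t (\<lambda>x. P s u x - u x) x + P t (\<lambda>x. - 1 * w x) x"
        unfolding r_def by (rule P_linear[OF t d mw])
      have 2: "AE x in M. P t (\<lambda>x. P s u x - u x) x = P t (P s u) x - P t u x"
        using s by (intro P_diff t P_L2 u) auto
      \<comment> \<open>The second instance of \<open>P_linear\<close> says that P t 0 equals its
        own double, hence vanishes almost everywhere.\<close>
      have 3: "AE x in M. P t (\<lambda>x. - 1 * w x) x = - P t w x"
        using P_linear[OF t w L2.zero, of "-1"] P_linear[OF t L2.zero L2.zero, of 1] by auto
      \<comment> \<open>The two ways of splitting the time s + t express that \<open>P s\<close> and
        \<open>P t\<close> commute.\<close>
      have 4: "AE x in M. P (t + s) u x = P t (P s u) x"
        using s by (intro P_add t u) auto
      have 5: "AE x in M. P (s + t) u x = P s (P t u) x"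
        using s by (intro P_add t u) auto
      show ?thesis using 1 2 3 4 5 by eventually_elim (simp add: add.commute)
    qed
    moreover have "(\<lambda>x. (P s (P t u) x - P t u x) / s - P t w x) \<in> L2 M"
      using L2.diff[OF L2.scale[of _ M "1/s"] P_L2[OF t w],
          OF L2.diff[OF P_L2[OF _ P_L2[OF t u]] P_L2[OF t u], of s]] s by simp
    ultimately have "l2_norm M (\<lambda>x. (P s (P t u) x - P t u x) / s - P t w x) = l2_norm M (P t r)"
      unfolding l2_norm_def by (subst l2_inner_cong_AE) (auto simp: P_L2 t r)
    also have "\<dots> \<le> l2_norm M r" by (rule P_contraction[OF t r])
    finally show ?thesis by (simp only: r_eq)
  qed
  have "((\<lambda>s. l2_norm M (\<lambda>x. (P s (P t u) x - P t u x) / s - P t w x)) \<longlongrightarrow> 0) (at_right 0)"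
  proof (rule Lim_null_comparison[OF _ lim])
    show "\<forall>\<^sub>F s in at_right 0. norm (l2_norm M (\<lambda>x. (P s (P t u) x - P t u x) / s - P t w x)) \<le>
        l2_norm M (\<lambda>x. (P s u x - u x) / s - w x)"
      using eventually_at_right_less[of 0]
      by eventually_elim
        (use bound in \<open>simp add: l2_norm_def l2_inner_def Bochner_Integration.integral_nonneg\<close>)
  qed
  then show ?thesis by (simp add: generator_rel_def P_L2 t u w)
qed

text \<open>On the generator domain the form is recovered from the operator as E(u,u) = - <w,u>, so
  the spectral gap becomes a dissipation estimate.\<close>

lemma generator_poincare:
  assumes "generator_rel M P u w"
  shows "l2_inner M u w \<le> - (gap * l2_var M u)"
proof -
  have "form_operator_rel M F \<E> u w"
    using assms associated by (simp add: associated_semigroup_def)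
  then have u: "u \<in> F" and w: "w \<in> L2 M" and E: "\<E> u u = - l2_inner M w u"
    by (auto simp: form_operator_rel_def)
  have "gap * l2_var M u \<le> \<E> u u"
    using poincare u
    by (simp add: poincare_inequality_def l2_var_def l2_inner_def power2_eq_square)
  then show ?thesis using E L2.sym[OF w F_L2[OF u]] by simp
qed

text \<open>An Euler step for the semigroup; the error is uniform in $t$ because $P_t$ is a
  contraction, so no differentiation of $t \mapsto P_t u$ is needed.\<close>

lemma l2_var_step:
  fixes u w s
  defines "r \<equiv> l2_norm M (\<lambda>x. (P s u x - u x) / s - w x)"
  assumes gen: "generator_rel M P u w" and t: "0 \<le> t" and s: "0 < s"
  shows "l2_var M (P (t + s) u) \<le> (1 - 2 * gap * s) * l2_var M (P t u)
    + s * (2 * l2_norm M u * r + s * (2 * (l2_norm M w)\<^sup>2 + 2 * r\<^sup>2))"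
proof -
  have u: "u \<in> L2 M" and w: "w \<in> L2 M" using gen by (auto simp: generator_rel_def)
  define z where "z = (\<lambda>x. (1/s) * (P s u x - u x))"
  define q where "q = (\<lambda>x. z x - w x)"
  have z: "z \<in> L2 M" unfolding z_def using s by (intro L2.scale L2.diff P_L2 u) auto
  have q: "q \<in> L2 M" unfolding q_def by (intro L2.diff z w)
  have r_eq: "r = l2_norm M q" by (simp add: r_def q_def z_def)
  have "AE x in M. P (t + s) u x = P t u x + s * P t z x"
  proof -
    have "P s u = (\<lambda>x. s * z x + u x)" using s by (simp add: z_def)
    then have "AE x in M. P t (P s u) x = s * P t z x + P t u x"
      using P_linear[OF t z u, of s] by simp
    moreover have "AE x in M. P (t + s) u x = P t (P s u) x"
      using s by (intro P_add t u) auto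
    ultimately show ?thesis by eventually_elim simp
  qed
  then have "l2_inner M (P (t + s) u) (P (t + s) u) =
      l2_inner M (\<lambda>x. P t u x + s * P t z x) (\<lambda>x. P t u x + s * P t z x)"
    using s t by (intro l2_inner_cong_AE) (auto simp: P_L2 u z L2.add L2.scale)
  also have "\<dots> = l2_inner M (P t u) (P t u) + 2 * s * l2_inner M (P t u) (P t z)
      + s\<^sup>2 * l2_inner M (P t z) (P t z)"
    by (intro L2.square_add P_L2 t u z)
  finally have split: "l2_var M (P (t + s) u) = l2_var M (P t u)
      + 2 * s * l2_inner M (P t u) (P t z) + s\<^sup>2 * l2_inner M (P t z) (P t z)"
    using s t u by (simp add: l2_var_def P_mean)
  \<comment> \<open>The quotient \<open>z\<close> is the generator value \<open>w\<close> plus the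
    error \<open>q\<close>: the first part produces the decay, the second is bounded by
    \<open>r\<close> uniformly in t.\<close>
  have "l2_inner M (P t u) (P t z) = l2_inner M (P t u) (P t w) + l2_inner M (P t u) (P t q)"
  proof -
    have "AE x in M. P t q x = P t z x - P t w x"
      unfolding q_def by (intro P_diff t z w)
    then have "l2_inner M (P t u) (P t q) = l2_inner M (P t u) (\<lambda>x. P t z x - P t w x)"
      by (intro l2_inner_cong_AE) (auto simp: P_L2 t u z w q L2.diff)
    then show ?thesis by (simp add: L2.diff_right P_L2 t u z w)
  qed
  moreover have "l2_inner M (P t u) (P t w) \<le> - (gap * l2_var M (P t u))"
    by (intro generator_poincare P_generator gen t)
  moreover have "l2_inner M (P t u) (P t q) \<le> l2_norm M u * r"
  proof -
    have "l2_inner M (P t u) (P t q) \<le> l2_norm M (P t u) * l2_norm M (P t q)"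
      using L2.abs_le_sqrt[OF P_L2[OF t u] P_L2[OF t q]] by (simp add: l2_norm_def)
    also have "\<dots> \<le> l2_norm M u * l2_norm M q"
      by (intro mult_mono P_contraction t u q) (auto simp: l2_norm_def L2.nonneg P_L2 t u q)
    finally show ?thesis by (simp add: r_eq)
  qed
  ultimately have "l2_inner M (P t u) (P t z) \<le> - (gap * l2_var M (P t u)) + l2_norm M u * r"
    by linarith
  then have 1: "2 * s * l2_inner M (P t u) (P t z) \<le>
      2 * s * (- (gap * l2_var M (P t u)) + l2_norm M u * r)"
    using s by (intro mult_left_mono) auto
  have "l2_inner M (P t z) (P t z) \<le> l2_inner M z z" by (intro P_contraction_square t z)
  also have "l2_inner M z z = l2_inner M (\<lambda>x. w x + q x) (\<lambda>x. w x + q x)" by (simp add: q_def)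
  also have "\<dots> \<le> 2 * (l2_norm M w)\<^sup>2 + 2 * r\<^sup>2"
    using L2.square_add_le[OF w q] by (simp add: r_eq l2_norm_square w q)
  finally have 2: "s\<^sup>2 * l2_inner M (P t z) (P t z) \<le> s\<^sup>2 * (2 * (l2_norm M w)\<^sup>2 + 2 * r\<^sup>2)"
    by (intro mult_left_mono) auto
  show ?thesis using split 1 2 by (simp add: algebra_simps power2_eq_square)
qed

text \<open>With Suc n steps of length s = T / Suc n, the contraction factors multiply to at most
  exp (-2 * gap * T), while the errors add up to at most T times \<delta> s, which tends to
  0.\<close>

lemma l2_var_decay_generator:
  assumes gen: "generator_rel M P u w" and T: "0 < T"
  shows "l2_var M (P T u) \<le> exp (- 2 * gap * T) * l2_var M u"
proof -
  have u: "u \<in> L2 M"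
    and lim: "((\<lambda>s. l2_norm M (\<lambda>x. (P s u x - u x) / s - w x)) \<longlongrightarrow> 0) (at_right 0)"
    using gen by (auto simp: generator_rel_def)
  define r where "r s = l2_norm M (\<lambda>x. (P s u x - u x) / s - w x)" for s
  define \<delta> where "\<delta> s = 2 * l2_norm M u * r s + s * (2 * (l2_norm M w)\<^sup>2 + 2 * (r s)\<^sup>2)" for s
  have r_lim: "(r \<longlongrightarrow> 0) (at_right 0)" using lim by (simp add: r_def[abs_def])
  have \<delta>_lim: "(\<delta> \<longlongrightarrow> 0) (at_right 0)"
    unfolding \<delta>_def[abs_def] by (rule tendsto_eq_intros r_lim refl | simp)+
  have seq: "filterlim (\<lambda>n. T / real (Suc n)) (at_right 0) sequentially"
  proof -
    have "(\<lambda>n. T / real (Suc n)) \<longlonglongrightarrow> 0"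
      using tendsto_mult_right_zero[OF LIMSEQ_inverse_real_of_nat, of T]
      by (simp add: divide_inverse)
    then show ?thesis using T by (auto simp: filterlim_at)
  qed
  have \<delta>_nonneg: "0 \<le> \<delta> s" if "0 < s" for s
    using that by (auto simp: \<delta>_def r_def l2_norm_def l2_inner_def)
  \<comment> \<open>The lower bound on n makes 1 - 2 * gap * s nonnegative, so the induction
    hypothesis may be multiplied by it.\<close>
  have bound: "l2_var M (P T u) \<le> exp (- 2 * gap * T) * l2_var M u + T * \<delta> (T / real (Suc n))"
    if n: "2 * gap * T \<le> real (Suc n)" for n
  proof -
    define s where "s = T / real (Suc n)"
    have s: "0 < s" using T by (simp add: s_def)
    have contr: "0 \<le> 1 - 2 * gap * s" "1 - 2 * gap * s \<le> 1"
      using n gap_pos s by (auto simp: s_def field_simps)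
    have step: "l2_var M (P (real k * s) u) \<le>
        (1 - 2 * gap * s) ^ k * l2_var M u + real k * (s * \<delta> s)" for k
    proof (induction k)
      case 0
      have "l2_var M (P 0 u) = l2_var M u"
        unfolding l2_var_def
        using P_zero[OF u] l2_inner_cong_AE[of "P 0 u" M u "P 0 u" u] P_mean[of 0 u] P_L2[of 0 u] u
        by simp
      then show ?case by simp
    next
      case (Suc k)
      have "real (Suc k) * s = real k * s + s" by (simp add: algebra_simps)
      then have "l2_var M (P (real (Suc k) * s) u) \<le>
          (1 - 2 * gap * s) * l2_var M (P (real k * s) u) + s * \<delta> s"
        using l2_var_step[OF gen _ s, of "real k * s"] s by (simp add: \<delta>_def r_def)
      also have "\<dots> \<le> (1 - 2 * gap * s) *
          ((1 - 2 * gap * s) ^ k * l2_var M u + real k * (s * \<delta> s)) + s * \<delta> s"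
        using contr Suc by (intro add_right_mono mult_left_mono)
      also have "\<dots> = (1 - 2 * gap * s) ^ Suc k * l2_var M u
          + (1 - 2 * gap * s) * (real k * (s * \<delta> s)) + s * \<delta> s"
        by (simp add: algebra_simps)
      \<comment> \<open>Damping of earlier errors is discarded; a linear accumulation is small
        enough.\<close>
      also have "\<dots> \<le> (1 - 2 * gap * s) ^ Suc k * l2_var M u + real k * (s * \<delta> s) + s * \<delta> s"
        using mult_right_mono[OF contr(2), of "real k * (s * \<delta> s)"] s \<delta>_nonneg[OF s] by simp
      finally show ?case by (simp add: algebra_simps)
    qed
    have Ts: "real (Suc n) * s = T" by (simp add: s_def)
    have "(1 - 2 * gap * s) ^ Suc n \<le> exp (- (2 * gap * s)) ^ Suc n"
      using exp_ge_add_one_self[of "- (2 * gap * s)"] contr by (intro power_mono) auto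
    also have "\<dots> = exp (- 2 * gap * T)"
      unfolding exp_of_nat_mult[symmetric] Ts[symmetric] by (simp add: algebra_simps)
    finally have "(1 - 2 * gap * s) ^ Suc n * l2_var M u \<le> exp (- 2 * gap * T) * l2_var M u"
      by (intro mult_right_mono l2_var_nonneg u)
    moreover have "real (Suc n) * (s * \<delta> s) = T * \<delta> s" using Ts by (metis mult.assoc)
    ultimately show ?thesis using step[of "Suc n"] unfolding Ts s_def[symmetric] by linarith
  qed
  show ?thesis
  proof (rule LIMSEQ_le_const)
    show "(\<lambda>n. exp (- 2 * gap * T) * l2_var M u + T * \<delta> (T / real (Suc n)))
        \<longlonglongrightarrow> exp (- 2 * gap * T) * l2_var M u"
      by (rule tendsto_eq_intros filterlim_compose[OF \<delta>_lim seq] refl | simp)+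
    obtain K where "2 * gap * T \<le> real K" using real_arch_simple by blast
    then have "2 * gap * T \<le> real (Suc n)" if "K \<le> n" for n using that by linarith
    then show "\<exists>K. \<forall>n\<ge>K. l2_var M (P T u) \<le>
        exp (- 2 * gap * T) * l2_var M u + T * \<delta> (T / real (Suc n))"
      using bound by blast
  qed
qed

section \<open>Extension of the decay by density\<close>

text \<open>The variance is continuous in L2, and contractivity carries the convergence of the
  initial data over to time T. It is applied once for each density step.\<close>

lemma l2_var_decay_limit:
  assumes T: "0 \<le> T" and u: "\<And>n. u n \<in> L2 M" and v: "v \<in> L2 M"
    and lim: "(\<lambda>n. l2_inner M (\<lambda>x. u n x - v x) (\<lambda>x. u n x - v x)) \<longlonglongrightarrow> 0"
    and decay: "\<And>n. l2_var M (P T (u n)) \<le> c * l2_var M (u n)"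
  shows "l2_var M (P T v) \<le> c * l2_var M v"
proof (rule LIMSEQ_le)
  have "l2_inner M (\<lambda>x. P T (u n) x - P T v x) (\<lambda>x. P T (u n) x - P T v x) \<le>
      l2_inner M (\<lambda>x. u n x - v x) (\<lambda>x. u n x - v x)" for n
  proof -
    have "l2_inner M (\<lambda>x. P T (u n) x - P T v x) (\<lambda>x. P T (u n) x - P T v x) =
        l2_inner M (P T (\<lambda>x. u n x - v x)) (P T (\<lambda>x. u n x - v x))"
      using P_diff[OF T u v, of n] by (intro l2_inner_cong_AE) (auto simp: L2.diff P_L2 T u v)
    also have "\<dots> \<le> l2_inner M (\<lambda>x. u n x - v x) (\<lambda>x. u n x - v x)"
      by (intro P_contraction_square T L2.diff u v)
    finally show ?thesis .
  qed
  then have "(\<lambda>n. l2_inner M (\<lambda>x. P T (u n) x - P T v x) (\<lambda>x. P T (u n) x - P T v x)) \<longlonglongrightarrow> 0"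
    by (intro Lim_null_comparison[OF always_eventually lim])
      (simp add: L2.nonneg L2.diff P_L2 T u v)
  then show "(\<lambda>n. l2_var M (P T (u n))) \<longlonglongrightarrow> l2_var M (P T v)"
    by (intro tendsto_l2_var P_L2 T u v)
  show "(\<lambda>n. c * l2_var M (u n)) \<longlonglongrightarrow> c * l2_var M v"
    by (intro tendsto_intros tendsto_l2_var u v lim)
qed (use decay in blast)

lemma l2_var_decay:
  assumes T: "0 < T" and f: "f \<in> L2 M"
  shows "l2_var M (P T f) \<le> exp (- 2 * gap * T) * l2_var M f"
proof -
  have decay_F: "l2_var M (P T g) \<le> exp (- 2 * gap * T) * l2_var M g" if g: "g \<in> F" for g
  proof -
    \<comment> \<open>Resolvents with parameter b = Suc n approximate \<open>g\<close> in L2 with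
      squared error at most E(g,g) / Suc n.\<close>
    have "\<exists>u. (\<exists>w. form_operator_rel M F \<E> u w) \<and>
        real (Suc n) * l2_inner M (\<lambda>x. u x - g x) (\<lambda>x. u x - g x) \<le> \<E> g g" for n
      using form_resolvent[OF dirichlet g, of "real (Suc n)"]
      by (metis Suc_le_mono le0 of_nat_1 of_nat_le_iff One_nat_def)
    then obtain u w where op: "\<And>n. form_operator_rel M F \<E> (u n) (w n)"
      and le: "\<And>n. real (Suc n) * l2_inner M (\<lambda>x. u n x - g x) (\<lambda>x. u n x - g x) \<le> \<E> g g"
      by metis
    have gen: "generator_rel M P (u n) (w n)" for n
      using op associated by (simp add: associated_semigroup_def)
    then have u: "u n \<in> L2 M" for n by (auto simp: generator_rel_def)
    have "(\<lambda>n. l2_inner M (\<lambda>x. u n x - g x) (\<lambda>x. u n x - g x)) \<longlonglongrightarrow> 0"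
    proof (rule Lim_null_comparison[OF always_eventually])
      show "\<forall>n. norm (l2_inner M (\<lambda>x. u n x - g x) (\<lambda>x. u n x - g x)) \<le> \<E> g g * inverse (real (Suc n))"
        using le L2.nonneg[OF L2.diff[OF u F_L2[OF g]]]
        by (simp add: field_simps del: of_nat_Suc)
      show "(\<lambda>n. \<E> g g * inverse (real (Suc n))) \<longlonglongrightarrow> 0"
        using tendsto_mult_right_zero[OF LIMSEQ_inverse_real_of_nat] .
    qed
    then show ?thesis
      using T by (intro l2_var_decay_limit[OF _ u F_L2[OF g]] l2_var_decay_generator[OF gen]) auto
  qed
  have "\<exists>g\<in>F. l2_norm M (\<lambda>x. f x - g x) < inverse (real (Suc n))" for n
    using dirichlet f by (simp add: symmetric_dirichlet_form_def densely_defined_def)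
  then obtain g where g: "\<And>n. g n \<in> F"
    and close: "\<And>n. l2_norm M (\<lambda>x. f x - g n x) < inverse (real (Suc n))"
    by metis
  have "(\<lambda>n. l2_norm M (\<lambda>x. f x - g n x)) \<longlonglongrightarrow> 0"
    using close by (intro Lim_null_comparison[OF always_eventually LIMSEQ_inverse_real_of_nat])
      (auto simp: l2_norm_def L2.nonneg L2.diff f F_L2 g intro: less_imp_le)
  from tendsto_power[OF this, of 2]
  have "(\<lambda>n. l2_inner M (\<lambda>x. f x - g n x) (\<lambda>x. f x - g n x)) \<longlonglongrightarrow> 0"
    by (simp add: l2_norm_square L2.diff f F_L2 g)
  then have "(\<lambda>n. l2_inner M (\<lambda>x. g n x - f x) (\<lambda>x. g n x - f x)) \<longlonglongrightarrow> 0"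
    by (simp add: l2_inner_def algebra_simps)
  then show ?thesis
    using T by (intro l2_var_decay_limit[OF _ F_L2[OF g] f] decay_F g) auto
qed

section \<open>From variance decay to the Besov seminorm of indicators\<close>

lemma indicator_L2: "A \<in> sets M \<Longrightarrow> (indicator A :: 'a \<Rightarrow> real) \<in> L2 M"
  by (simp add: L2_def power2_eq_square integrable_real_indicator emeasure_eq_measure
      flip: indicator_inter_arith)

text \<open>Splitting t into two halves and using symmetry turns the correlation into the squared
  norm of P (t/2) applied to the indicator. Decay over time t/2 with rate 2 * gap gives the exponent
  gap * t.\<close>

lemma indicator_correlation_le:
  assumes A: "A \<in> sets M" and t: "0 < t"
  shows "l2_inner M (indicator A) (P t (indicator A)) \<le>
    (measure M A)\<^sup>2 + exp (- gap * t) * (measure M A - (measure M A)\<^sup>2)"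
proof -
  let ?f = "indicator A :: 'a \<Rightarrow> real"
  have f: "?f \<in> L2 M" by (rule indicator_L2[OF A])
  have mean: "l2_inner M ?f (\<lambda>_. 1) = measure M A" and "l2_inner M ?f ?f = measure M A"
    using A by (simp_all add: l2_inner_def flip: indicator_inter_arith)
  then have var: "l2_var M ?f = measure M A - (measure M A)\<^sup>2"
    by (simp add: l2_var_def)
  have "l2_inner M ?f (P t ?f) = l2_inner M ?f (P (t/2) (P (t/2) ?f))"
    using t f P_add[of "t/2" "t/2" ?f] by (intro l2_inner_cong_AE) (auto simp: P_L2)
  also have "\<dots> = l2_inner M (P (t/2) ?f) (P (t/2) ?f)"
    using t f P_symmetric[of "t/2" ?f "P (t/2) ?f"] by (simp add: P_L2)
  also have "\<dots> = l2_var M (P (t/2) ?f) + (measure M A)\<^sup>2"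
    using t f by (simp add: l2_var_def P_mean mean)
  finally show ?thesis
    using l2_var_decay[of "t/2" ?f] t f by (simp add: var)
qed

text \<open>For values a, b in {0,1} one has |a - b| = a + b - 2ab, which is affine in a. The kernel
  integral thus reduces to \<open>P t\<close> of the indicator and to the total mass of the kernel;
  integrating in y uses \<open>P_mean\<close>.\<close>

lemma nn_integral_indicator_oscillation:
  assumes kernel: "heat_kernel_measures M P p" and A: "A \<in> sets M" and t: "0 < t"
  shows "(\<integral>\<^sup>+ y. (\<integral>\<^sup>+ x. ennreal \<bar>indicator A x - indicator A y\<bar> \<partial>p t y) \<partial>M) =
    ennreal (2 * (measure M A - l2_inner M (indicator A) (P t (indicator A))))"
proof -
  let ?f = "indicator A :: 'a \<Rightarrow> real"
  have f: "?f \<in> L2 M" by (rule indicator_L2[OF A])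
  have Pf: "P t ?f \<in> L2 M" using t by (intro P_L2 f) auto
  have rep: "\<And>g. g \<in> L2 M \<Longrightarrow> AE y in M. integrable (p t y) g \<and> P t g y = (\<integral>x. g x \<partial>p t y)"
    using kernel t by (auto simp: heat_kernel_measures_def)
  have one: "AE y in M. P t (\<lambda>_. 1) y = 1"
    using conservative t by (simp add: conservative_def)
  let ?h = "\<lambda>y. ?f y + P t ?f y - 2 * (?f y * P t ?f y)"
  \<comment> \<open>Nonnegativity of \<open>?h\<close> is carried along so that the outer integral
    can also be turned into a Bochner integral.\<close>
  have AE: "AE y in M. (\<integral>\<^sup>+ x. ennreal \<bar>?f x - ?f y\<bar> \<partial>p t y) = ennreal (?h y) \<and> 0 \<le> ?h y"
    using rep[OF f] rep[OF one_L2] one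
  proof eventually_elim
    case (elim y)
    then have int: "integrable (p t y) ?f" "integrable (p t y) (\<lambda>_. 1 :: real)"
      and val: "(\<integral>x. ?f x \<partial>p t y) = P t ?f y" "(\<integral>x. 1 \<partial>p t y) = (1 :: real)" by auto
    \<comment> \<open>The factor 1 stands for the constant function: the kernels are only
      subprobabilities, and their mass one comes from conservativeness through
      \<open>val\<close>.\<close>
    have eq: "\<bar>?f x - ?f y\<bar> = ?f x + ?f y * 1 - 2 * ?f y * ?f x" for x
      by (auto simp: indicator_def)
    have "integrable (p t y) (\<lambda>x. \<bar>?f x - ?f y\<bar>)"
      unfolding eq by (intro Bochner_Integration.integrable_add Bochner_Integration.integrable_diff
        integrable_mult_right int)
    then have "(\<integral>\<^sup>+ x. ennreal \<bar>?f x - ?f y\<bar> \<partial>p t y) = ennreal (\<integral>x. \<bar>?f x - ?f y\<bar> \<partial>p t y)"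
      by (intro nn_integral_eq_integral) auto
    moreover have "(\<integral>x. \<bar>?f x - ?f y\<bar> \<partial>p t y) = ?h y"
    proof -
      have "(\<integral>x. \<bar>?f x - ?f y\<bar> \<partial>p t y) =
          (\<integral>x. ?f x \<partial>p t y) + ?f y * (\<integral>x. 1 \<partial>p t y) - 2 * ?f y * (\<integral>x. ?f x \<partial>p t y)"
        unfolding eq
        by (subst Bochner_Integration.integral_diff Bochner_Integration.integral_add integral_mult_right_zero,
            (intro Bochner_Integration.integrable_add integrable_mult_right int)+)+ simp
      then show ?thesis unfolding val by simp
    qed
    moreover have "0 \<le> (\<integral>x. \<bar>?f x - ?f y\<bar> \<partial>p t y)" by simp
    ultimately show ?case by simp
  qed
  have int: "integrable M ?f" "integrable M (P t ?f)" "integrable M (\<lambda>y. ?f y * P t ?f y)"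
    using L2_integrable_mult[OF f one_L2] L2_integrable_mult[OF Pf one_L2] L2_integrable_mult[OF f Pf]
    by simp_all
  have "(\<integral>\<^sup>+ y. (\<integral>\<^sup>+ x. ennreal \<bar>?f x - ?f y\<bar> \<partial>p t y) \<partial>M) = (\<integral>\<^sup>+ y. ennreal (?h y) \<partial>M)"
    using AE by (intro nn_integral_cong_AE) auto
  also have "\<dots> = ennreal (\<integral>y. ?h y \<partial>M)"
    using AE int by (intro nn_integral_eq_integral) auto
  also have "(\<integral>y. ?h y \<partial>M) = measure M A + l2_inner M (P t ?f) (\<lambda>_. 1)
      - 2 * l2_inner M ?f (P t ?f)"
    using int A by (simp add: l2_inner_def)
  also have "l2_inner M (P t ?f) (\<lambda>_. 1) = measure M A"
    using P_mean[of t ?f] t f A by (simp add: l2_inner_def)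
  finally show ?thesis by simp
qed

lemma besov_seminorm_indicator_ge:
  assumes kernel: "heat_kernel_measures M P p" and A: "A \<in> sets M" and half: "measure M A \<le> 1/2"
  shows "ennreal ((1 - exp (-1)) * gap powr \<alpha> * measure M A) \<le> besov_seminorm M p \<alpha> (indicator A)"
proof -
  let ?m = "measure M A" and ?t = "1 / gap"
  let ?f = "indicator A :: 'a \<Rightarrow> real"
  have t: "0 < ?t" using gap_pos by simp
  have "(1 - exp (-1)) * ?m * 1 \<le> (1 - exp (-1)) * ?m * (2 * (1 - ?m))"
    using half by (intro mult_left_mono) auto
  also have "\<dots> = 2 * (?m - (?m\<^sup>2 + exp (-1) * (?m - ?m\<^sup>2)))"
    by (simp add: algebra_simps power2_eq_square)
  also have "\<dots> \<le> 2 * (?m - l2_inner M ?f (P ?t ?f))"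
    using indicator_correlation_le[OF A t] gap_pos by simp
  finally have "gap powr \<alpha> * ((1 - exp (-1)) * ?m) \<le> gap powr \<alpha> * (2 * (?m - l2_inner M ?f (P ?t ?f)))"
    by (intro mult_left_mono) auto
  then have "ennreal ((1 - exp (-1)) * gap powr \<alpha> * ?m) \<le>
      ennreal (gap powr \<alpha> * (2 * (?m - l2_inner M ?f (P ?t ?f))))"
    by (intro ennreal_leI) (simp add: mult_ac)
  also have "\<dots> = ennreal (?t powr (- \<alpha>)) *
      (\<integral>\<^sup>+ y. (\<integral>\<^sup>+ x. ennreal \<bar>?f x - ?f y\<bar> \<partial>p ?t y) \<partial>M)"
    using gap_pos unfolding nn_integral_indicator_oscillation[OF kernel A t]
    by (simp add: ennreal_mult' powr_divide powr_minus)
  also have "\<dots> \<le> besov_seminorm M p \<alpha> ?f"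
    unfolding besov_seminorm_def by (rule SUP_upper) (use t in simp)
  finally show ?thesis .
qed

end

theorem theorem0p7:
  fixes M :: "'a::topological_space measure"
    and F :: "('a \<Rightarrow> real) set"
    and \<E> :: "('a \<Rightarrow> real) \<Rightarrow> ('a \<Rightarrow> real) \<Rightarrow> real"
    and P :: "real \<Rightarrow> ('a \<Rightarrow> real) \<Rightarrow> 'a \<Rightarrow> real"
    and p :: "real \<Rightarrow> 'a \<Rightarrow> 'a measure"
    and gap \<alpha> :: real
  assumes "symmetric_dirichlet_space M F \<E>"
    and "associated_semigroup M F \<E> P"
    and "heat_kernel_measures M P p"
    and "conservative M P"
    and "emeasure M (space M) = 1"
    and "is_spectral_gap M F \<E> gap" and "gap > 0"
    and "0 < \<alpha>" and "\<alpha> \<le> 1"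
  shows "cheeger_constant M p \<alpha> \<ge> ennreal ((1 - exp (-1)) * gap powr \<alpha>)"
proof -
  interpret prob_space M by (rule prob_spaceI) (rule assms(5))
  interpret poincare_semigroup M F \<E> P gap
    by unfold_locales
      (use assms in \<open>auto simp: symmetric_dirichlet_space_def is_spectral_gap_def\<close>)
  show ?thesis
    unfolding cheeger_constant_def
  \<comment> \<open>This rule also covers an empty family of sets, where the infimum is
    infinite.\<close>
  proof (rule INF_greatest)
    fix A
    assume "A \<in> {A \<in> sets M. 0 < measure M A \<and> measure M A \<le> 1/2 \<and>
      (indicator A :: 'a \<Rightarrow> real) \<in> besov_space M p \<alpha>}"
    then have A: "A \<in> sets M" "0 < measure M A" "measure M A \<le> 1/2" by auto
    have "ennreal ((1 - exp (-1)) * gap powr \<alpha>) =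
        ennreal ((1 - exp (-1)) * gap powr \<alpha> * measure M A) / emeasure M A"
      using A(2) by (simp add: emeasure_eq_measure divide_ennreal)
    also have "\<dots> \<le> besov_seminorm M p \<alpha> (indicator A) / emeasure M A"
      by (intro divide_right_mono_ennreal besov_seminorm_indicator_ge assms A)
    finally show "ennreal ((1 - exp (-1)) * gap powr \<alpha>) \<le>
        besov_seminorm M p \<alpha> (indicator A) / emeasure M A" .
  qed
qed

end
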